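(* Let $\mathcal K$ be a finite nonempty set and let $\rho_1,\rho_2>0$ and, for each $k\in\mathcal K$, $\varsigma_k,\kappa_k,\gamma_k,D_k,f_k^{\max}>0$ be given. Consider the problem $$\mathcal{SP}1:\quad \min_{\boldsymbol f}\ Q_1(\boldsymbol f)=\rho_1\sum_{k\in\mathcal K}\varsigma_k\kappa_k\gamma_kD_kf_k^2+\rho_2\max_{k\in\mathcal K}\frac{\kappa_k\gamma_kD_k}{f_k}\quad\text{s.t. } 0\le f_k\le f_k^{\max}\ \ \forall k\in\mathcal K .$$ For each $l\in\mathcal K$ let $\boldsymbol f_l^*$ denote the optimal solution of $$\min_{\boldsymbol f}\ \rho_1\sum_{k\in\mathcal K}\varsigma_k\kappa_k\gamma_kD_kf_k^2+\rho_2\frac{\kappa_l\gamma_lD_l}{f_l}\quad\text{s.t. } \frac{\kappa_k\gamma_kD_k f_l}{\kappa_l\gamma_lD_l}\le f_k,\ \ 0\le f_k\le f_k^{\max}\ \ \forall k\in\mathcal K .$$ Then a globally optimal solution to $\mathcal{SP}1$ is $$\boldsymbol f^*=\operatorname*{argmin}_{\boldsymbol f\in\{\boldsymbol f_l^*\}_{l\in\mathcal K}}Q_1(\boldsymbol f).$$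
   Context: $\boldsymbol f=(f_k)_{k\in\mathcal K}$ is the vector of CPU frequencies of the users; a quotient with zero denominator and positive numerator is read as $+\infty$. The second problem is the version of $\mathcal{SP}1$ in which user $l$ is assumed to be the straggler (the user with the largest computation time $\kappa_k\gamma_kD_k/f_k$). *)

theory Defs
  imports "HOL-Analysis.Analysis"
begin

(* Objectives take values in ereal: on ereal, c / 0 = \<infinity> for c > 0, which is the intended
   reading of the computation time at zero frequency (on real it would be 0). *)

definition comp_time ::
    "('k::finite \<Rightarrow> real) \<Rightarrow> ('k \<Rightarrow> real) \<Rightarrow> ('k \<Rightarrow> real) \<Rightarrow> real ^ 'k \<Rightarrow> 'k \<Rightarrow> ereal" where
  "comp_time \<kappa> \<gamma> D f k = ereal (\<kappa> k * \<gamma> k * D k) / ereal (f $ k)"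

lemma comp_time_at_zero:
  assumes "\<kappa> k > 0" "\<gamma> k > 0" "D k > 0" "f $ k = 0"
  shows "comp_time \<kappa> \<gamma> D f k = \<infinity>"
  using assms by (simp add: comp_time_def divide_ereal_def)

definition energy ::
    "('k::finite \<Rightarrow> real) \<Rightarrow> ('k \<Rightarrow> real) \<Rightarrow> ('k \<Rightarrow> real) \<Rightarrow> ('k \<Rightarrow> real) \<Rightarrow> real ^ 'k \<Rightarrow> real" where
  "energy \<sigma> \<kappa> \<gamma> D f = (\<Sum>k\<in>UNIV. \<sigma> k * \<kappa> k * \<gamma> k * D k * (f $ k)\<^sup>2)"

definition SP1_feasible :: "('k::finite \<Rightarrow> real) \<Rightarrow> real ^ 'k \<Rightarrow> bool" where
  "SP1_feasible fmax f \<longleftrightarrow> (\<forall>k. 0 \<le> f $ k \<and> f $ k \<le> fmax k)"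

definition Q1 ::
    "real \<Rightarrow> real \<Rightarrow> ('k::finite \<Rightarrow> real) \<Rightarrow> ('k \<Rightarrow> real) \<Rightarrow> ('k \<Rightarrow> real) \<Rightarrow> ('k \<Rightarrow> real)
      \<Rightarrow> real ^ 'k \<Rightarrow> ereal" where
  "Q1 \<rho>1 \<rho>2 \<sigma> \<kappa> \<gamma> D f =
     ereal (\<rho>1 * energy \<sigma> \<kappa> \<gamma> D f) + ereal \<rho>2 * (MAX k. comp_time \<kappa> \<gamma> D f k)"

definition straggler_feasible ::
    "('k::finite \<Rightarrow> real) \<Rightarrow> ('k \<Rightarrow> real) \<Rightarrow> ('k \<Rightarrow> real) \<Rightarrow> ('k \<Rightarrow> real) \<Rightarrow> 'k
      \<Rightarrow> real ^ 'k \<Rightarrow> bool" where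
  "straggler_feasible \<kappa> \<gamma> D fmax l f \<longleftrightarrow>
     (\<forall>k. \<kappa> k * \<gamma> k * D k * f $ l / (\<kappa> l * \<gamma> l * D l) \<le> f $ k \<and> 0 \<le> f $ k \<and> f $ k \<le> fmax k)"

definition straggler_obj ::
    "real \<Rightarrow> real \<Rightarrow> ('k::finite \<Rightarrow> real) \<Rightarrow> ('k \<Rightarrow> real) \<Rightarrow> ('k \<Rightarrow> real) \<Rightarrow> ('k \<Rightarrow> real) \<Rightarrow> 'k
      \<Rightarrow> real ^ 'k \<Rightarrow> ereal" where
  "straggler_obj \<rho>1 \<rho>2 \<sigma> \<kappa> \<gamma> D l f =
     ereal (\<rho>1 * energy \<sigma> \<kappa> \<gamma> D f) + ereal \<rho>2 * comp_time \<kappa> \<gamma> D f l"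

definition straggler_opt ::
    "real \<Rightarrow> real \<Rightarrow> ('k::finite \<Rightarrow> real) \<Rightarrow> ('k \<Rightarrow> real) \<Rightarrow> ('k \<Rightarrow> real) \<Rightarrow> ('k \<Rightarrow> real)
      \<Rightarrow> ('k \<Rightarrow> real) \<Rightarrow> 'k \<Rightarrow> real ^ 'k" where
  "straggler_opt \<rho>1 \<rho>2 \<sigma> \<kappa> \<gamma> D fmax l =
     (THE f. is_arg_min (straggler_obj \<rho>1 \<rho>2 \<sigma> \<kappa> \<gamma> D l) (straggler_feasible \<kappa> \<gamma> D fmax l) f)"

end

theory Submission imports Defs begin

text \<open>
  Write \<open>a k = \<kappa> k * \<gamma> k * D k\<close>. With \<open>f $ l = s * a l\<close> prescribed, the constraints of the straggler
  problem read \<open>s * a k \<le> f $ k\<close>, and the energy is least exactly when all of them are tight. What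
  remains is to minimise \<open>A * s\<^sup>2 + \<rho>2 / s\<close> over \<open>0 < s \<le> Min (fmax k / a k)\<close>, a problem that has a
  unique solution \<open>s\<^sub>0\<close> and no longer mentions \<open>l\<close>: all straggler optima are the same point
  \<open>s\<^sub>0 * a\<close>. Finally, a point feasible for \<open>\<S>\<P>1\<close> with straggler \<open>l\<close> is feasible for the straggler
  problem of \<open>l\<close>, with the same objective value.
\<close>

text \<open>The derivative \<open>2 * A * s - B / s\<^sup>2\<close> vanishes only at
  \<open>root 3 (B / (2 * A))\<close>; cutting this point off at \<open>S\<close> gives the
  minimiser on \<open>0 < s \<le> S\<close>. Strictness off \<open>s0\<close> will yield
  uniqueness.\<close>

lemma quadratic_plus_inverse_less:
  fixes A B S s :: real
  assumes "A > 0" "B > 0"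
  defines "s0 \<equiv> min S (root 3 (B / (2 * A)))"
  assumes s: "0 < s" "s \<le> S" "s \<noteq> s0"
  shows "A * s0\<^sup>2 + B / s0 < A * s\<^sup>2 + B / s"
proof -
  define c where "c = root 3 (B / (2 * A))"
  have c: "c > 0" "2 * A * c ^ 3 = B"
    using assms(1,2) by (simp_all add: c_def)
  have s0: "0 < s0" "s0 = min S c"
    using s c by (auto simp: s0_def c_def)
  \<comment> \<open>The product is \<open>s * s0\<close> times the difference of the two values. Its
    factors have equal signs, by comparing \<open>s * s0 * (s + s0)\<close> with
    \<open>2 * c ^ 3 = B / A\<close>.\<close>
  have "0 < (s - s0) * (A * (s * s0 * (s + s0)) - B)"
  proof (cases "s < s0")
    case True
    have "s * s0 * (s + s0) < c * c * (c + c)"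
      using True s s0 c(1) by (intro mult_less_le_imp_less) auto
    also have "\<dots> = 2 * c ^ 3"
      by (simp add: power3_eq_cube)
    finally have "A * (s * s0 * (s + s0)) < A * (2 * c ^ 3)"
      using assms(1) by (rule mult_strict_left_mono)
    then show ?thesis
      using c(2) True by (intro mult_neg_neg) auto
  next
    case False
    \<comment> \<open>Since \<open>s0 < s \<le> S\<close>, the cap \<open>S\<close> is not active,
      so the minimum is \<open>c\<close>.\<close>
    then have "s0 < s" "s0 = c"
      using s s0 by auto
    have "2 * c ^ 3 = c * c * (c + c)"
      by (simp add: power3_eq_cube)
    also have "\<dots> < s * s0 * (s + s0)"
      using \<open>s0 < s\<close> \<open>s0 = c\<close> c(1) by (intro mult_less_le_imp_less) auto
    finally have "A * (2 * c ^ 3) < A * (s * s0 * (s + s0))"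
      using assms(1) by (rule mult_strict_left_mono)
    then show ?thesis
      using c(2) \<open>s0 < s\<close> by (intro mult_pos_pos) auto
  qed
  also have "\<dots> = s * s0 * ((A * s\<^sup>2 + B / s) - (A * s0\<^sup>2 + B / s0))"
    using s s0 by (simp add: field_simps power2_eq_square)
  finally have "0 < (A * s\<^sup>2 + B / s) - (A * s0\<^sup>2 + B / s0)"
    by (rule zero_less_mult_pos) (use s(1) s0(1) in simp)
  then show ?thesis
    by simp
qed

locale straggler_problem =
  fixes \<rho>1 \<rho>2 :: real and \<sigma> \<kappa> \<gamma> D fmax :: "'k::finite \<Rightarrow> real"
  assumes \<rho>1: "\<rho>1 > 0" and \<rho>2: "\<rho>2 > 0"
    and \<sigma>: "\<And>k. \<sigma> k > 0" and \<kappa>: "\<And>k. \<kappa> k > 0" and \<gamma>: "\<And>k. \<gamma> k > 0" and D: "\<And>k. D k > 0"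
    and fmax: "\<And>k. fmax k > 0"
begin

definition a :: "'k \<Rightarrow> real" where "a k = \<kappa> k * \<gamma> k * D k"

text \<open>The minimum over \<open>k\<close> is the largest \<open>s\<close> for which
  \<open>s * a k\<close> respects every bound \<open>fmax k\<close>; the cube root is the stationary
  point of the one-variable objective.\<close>

definition s_opt :: real where
  "s_opt = min (MIN k. fmax k / a k) (root 3 (\<rho>2 / (2 * (\<rho>1 * energy \<sigma> \<kappa> \<gamma> D (\<chi> k. a k)))))"

definition f_opt :: "real ^ 'k" where "f_opt = s_opt *\<^sub>R (\<chi> k. a k)"

lemma a_pos: "a k > 0"
  using \<kappa> \<gamma> D by (simp add: a_def)

lemma energy_eq: "energy \<sigma> \<kappa> \<gamma> D f = (\<Sum>k\<in>UNIV. \<sigma> k * a k * (f $ k)\<^sup>2)"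
  by (simp add: energy_def a_def mult.assoc)

lemma energy_scaleR: "energy \<sigma> \<kappa> \<gamma> D (s *\<^sub>R f) = s\<^sup>2 * energy \<sigma> \<kappa> \<gamma> D f"
  by (simp add: energy_eq power_mult_distrib sum_distrib_left mult.left_commute)

text \<open>All weights are positive, so one strictly larger coordinate suffices. This makes the
  tight point the only energy minimiser once \<open>f $ l\<close> is fixed.\<close>

lemma energy_strict_mono:
  assumes "\<And>k. 0 \<le> g $ k" "\<And>k. g $ k \<le> f $ k" "f \<noteq> g"
  shows "energy \<sigma> \<kappa> \<gamma> D g < energy \<sigma> \<kappa> \<gamma> D f"
proof -
  obtain j where "g $ j \<noteq> f $ j"
    using assms(3) by (metis vec_eq_iff)
  then have "g $ j < f $ j"
    using assms(2)[of j] by simp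
  then have "\<sigma> j * a j * (g $ j)\<^sup>2 < \<sigma> j * a j * (f $ j)\<^sup>2"
    using \<sigma> a_pos assms(1) by (intro mult_strict_left_mono power_strict_mono) auto
  moreover have "\<sigma> k * a k * (g $ k)\<^sup>2 \<le> \<sigma> k * a k * (f $ k)\<^sup>2" for k
    using \<sigma>[of k] a_pos[of k] assms(1,2) by (intro mult_left_mono power_mono) auto
  ultimately show ?thesis
    unfolding energy_eq by (intro sum_strict_mono_ex1) auto
qed

lemma energy_a_pos: "0 < energy \<sigma> \<kappa> \<gamma> D (\<chi> k. a k)"
  unfolding energy_eq using \<sigma> a_pos less_imp_neq[OF a_pos] by (intro sum_pos) auto

lemma s_opt_pos: "0 < s_opt"
  using \<rho>1 \<rho>2 energy_a_pos fmax a_pos by (simp add: s_opt_def)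

lemma comp_time_pos:
  assumes "f $ k > 0"
  shows "comp_time \<kappa> \<gamma> D f k = ereal (a k / f $ k)"
  using assms by (simp add: comp_time_def a_def)

lemma comp_time_zero:
  assumes "f $ k = 0"
  shows "comp_time \<kappa> \<gamma> D f k = \<infinity>"
  using assms \<kappa> \<gamma> D by (intro comp_time_at_zero)

text \<open>Cross-multiplication survives zero frequencies: if \<open>f $ l = 0\<close>, both sides
  hold; if only \<open>f $ k = 0\<close>, both fail.\<close>

lemma comp_time_le_iff:
  assumes "0 \<le> f $ k" "0 \<le> f $ l"
  shows "comp_time \<kappa> \<gamma> D f k \<le> comp_time \<kappa> \<gamma> D f l \<longleftrightarrow> a k * f $ l \<le> a l * f $ k"
proof (cases "f $ l = 0")
  case True
  then show ?thesis
    using assms a_pos[of l] by (simp add: comp_time_zero)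
next
  case l: False
  show ?thesis
  proof (cases "f $ k = 0")
    case True
    then show ?thesis
      using l assms a_pos[of k] by (simp add: comp_time_zero comp_time_pos mult_le_0_iff)
  next
    case False
    then show ?thesis
      using l assms by (simp add: comp_time_pos field_simps)
  qed
qed

lemma straggler_feasible_alt:
  "straggler_feasible \<kappa> \<gamma> D fmax l f \<longleftrightarrow>
     (\<forall>k. f $ l / a l * a k \<le> f $ k \<and> 0 \<le> f $ k \<and> f $ k \<le> fmax k)"
  by (simp add: straggler_feasible_def a_def mult.commute)

text \<open>The ratio constraint is the cross-multiplied form of \<open>l\<close> being slowest, so
  each straggler problem is a restriction of the original one.\<close>

lemma straggler_feasible_iff:
  "straggler_feasible \<kappa> \<gamma> D fmax l f \<longleftrightarrow>
     SP1_feasible fmax f \<and> (\<forall>k. comp_time \<kappa> \<gamma> D f k \<le> comp_time \<kappa> \<gamma> D f l)"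
proof -
  have "f $ l / a l * a k \<le> f $ k \<longleftrightarrow> a k * f $ l \<le> a l * f $ k" for k
    using a_pos[of l] by (simp add: field_simps)
  then show ?thesis
    by (auto simp: straggler_feasible_alt SP1_feasible_def comp_time_le_iff)
qed

lemma Q1_eq_straggler_obj:
  assumes "straggler_feasible \<kappa> \<gamma> D fmax l f"
  shows "Q1 \<rho>1 \<rho>2 \<sigma> \<kappa> \<gamma> D f = straggler_obj \<rho>1 \<rho>2 \<sigma> \<kappa> \<gamma> D l f"
proof -
  have "(MAX k. comp_time \<kappa> \<gamma> D f k) = comp_time \<kappa> \<gamma> D f l"
    using assms by (intro Max_eqI) (auto simp: straggler_feasible_iff)
  then show ?thesis
    by (simp add: Q1_def straggler_obj_def)
qed

lemma straggler_exists:
  assumes "SP1_feasible fmax f"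
  shows "\<exists>l. straggler_feasible \<kappa> \<gamma> D fmax l f"
proof -
  have "(MAX k. comp_time \<kappa> \<gamma> D f k) \<in> range (comp_time \<kappa> \<gamma> D f)"
    by (intro Max_in) auto
  then obtain l where "(MAX k. comp_time \<kappa> \<gamma> D f k) = comp_time \<kappa> \<gamma> D f l"
    by blast
  then have "comp_time \<kappa> \<gamma> D f k \<le> comp_time \<kappa> \<gamma> D f l" for k
    by (metis Max_ge finite finite_imageI rangeI)
  then show ?thesis
    using assms by (auto simp: straggler_feasible_iff)
qed

lemma f_opt_feasible: "straggler_feasible \<kappa> \<gamma> D fmax l f_opt"
proof -
  have "s_opt * a k \<le> fmax k" for k
  proof -
    have "s_opt \<le> (MIN k. fmax k / a k)"
      by (simp add: s_opt_def)
    also have "\<dots> \<le> fmax k / a k"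
      by (intro Min_le) auto
    finally show ?thesis
      using a_pos[of k] by (simp add: field_simps)
  qed
  then show ?thesis
    using s_opt_pos a_pos less_imp_le[OF a_pos] less_imp_neq[OF a_pos]
    by (auto simp: straggler_feasible_alt f_opt_def)
qed

lemma straggler_obj_pos:
  assumes "f $ l = s * a l" "s > 0"
  shows "straggler_obj \<rho>1 \<rho>2 \<sigma> \<kappa> \<gamma> D l f = ereal (\<rho>1 * energy \<sigma> \<kappa> \<gamma> D f + \<rho>2 / s)"
  using assms a_pos[of l] by (simp add: straggler_obj_def comp_time_pos)

text \<open>Two moves lead from \<open>f\<close> to \<open>f_opt\<close>: lower all coordinates to
  the tight point with the same \<open>f $ l\<close>, then change the scale to \<open>s_opt\<close>.
  Neither increases the objective, and at least one strictly decreases it.\<close>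

lemma f_opt_strict_min:
  assumes f: "straggler_feasible \<kappa> \<gamma> D fmax l f" and "f \<noteq> f_opt"
  shows "straggler_obj \<rho>1 \<rho>2 \<sigma> \<kappa> \<gamma> D l f_opt < straggler_obj \<rho>1 \<rho>2 \<sigma> \<kappa> \<gamma> D l f"
proof -
  define E where "E = energy \<sigma> \<kappa> \<gamma> D (\<chi> k. a k)"
  define s where "s = f $ l / a l"
  have s: "f $ l = s * a l"
    using a_pos[of l] by (simp add: s_def)
  have le: "s * a k \<le> f $ k" "0 \<le> f $ k" "f $ k \<le> fmax k" for k
    using f by (auto simp: straggler_feasible_alt s_def)
  have obj_opt: "straggler_obj \<rho>1 \<rho>2 \<sigma> \<kappa> \<gamma> D l f_opt = ereal (\<rho>1 * E * s_opt\<^sup>2 + \<rho>2 / s_opt)"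
    using straggler_obj_pos[of f_opt l s_opt] s_opt_pos
    by (simp add: f_opt_def energy_scaleR E_def mult_ac)
  have "0 \<le> s"
    using le(2)[of l] a_pos[of l] by (simp add: s_def)
  then consider "s = 0" | "s > 0"
    by linarith
  then show ?thesis
  proof cases
    case 1
    \<comment> \<open>At zero frequency the time is infinite, whereas \<open>f_opt\<close> has a
      finite value.\<close>
    then have "straggler_obj \<rho>1 \<rho>2 \<sigma> \<kappa> \<gamma> D l f = \<infinity>"
      using s \<rho>2 by (simp add: straggler_obj_def comp_time_zero)
    then show ?thesis
      by (simp add: obj_opt)
  next
    case 2
    define g where "g = s *\<^sub>R (\<chi> k. a k)"
    have g: "0 \<le> g $ k" "g $ k \<le> f $ k" for k
      using 2 le(1) less_imp_le[OF a_pos] by (auto simp: g_def)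
    have obj_g: "energy \<sigma> \<kappa> \<gamma> D g = E * s\<^sup>2"
      by (simp add: g_def energy_scaleR E_def)
    \<comment> \<open>Chaining \<open>s * a k \<le> f $ k \<le> fmax k\<close> puts \<open>s\<close>
      in the range over which \<open>s_opt\<close> is optimal.\<close>
    have "s \<le> fmax k / a k" for k
      using order.trans[OF le(1,3)] a_pos[of k] by (simp add: field_simps)
    then have "s \<le> (MIN k. fmax k / a k)"
      by simp
    then have less: "\<rho>1 * E * s_opt\<^sup>2 + \<rho>2 / s_opt < \<rho>1 * E * s\<^sup>2 + \<rho>2 / s" if "s \<noteq> s_opt"
      using quadratic_plus_inverse_less[of "\<rho>1 * E" \<rho>2 s] 2 \<rho>1 \<rho>2 energy_a_pos that
      by (simp add: s_opt_def E_def)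
    have "\<rho>1 * E * s_opt\<^sup>2 + \<rho>2 / s_opt < \<rho>1 * energy \<sigma> \<kappa> \<gamma> D f + \<rho>2 / s"
    proof (cases "f = g")
      case True
      then have "s \<noteq> s_opt"
        using assms(2) by (auto simp: g_def f_opt_def)
      then show ?thesis
        using less True obj_g by (simp add: mult.assoc)
    next
      case False
      then have "\<rho>1 * (E * s\<^sup>2) < \<rho>1 * energy \<sigma> \<kappa> \<gamma> D f"
        using energy_strict_mono[OF g] \<rho>1 by (simp add: obj_g)
      then show ?thesis
        using less by (cases "s = s_opt") (auto simp: mult.assoc)
    qed
    then show ?thesis
      by (simp add: obj_opt straggler_obj_pos[OF s 2])
  qed
qed

text \<open>Strict minimality gives existence and uniqueness together, so the \<open>THE\<close> in
  \<open>straggler_opt\<close> is well defined.\<close>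

lemma is_arg_min_straggler_iff:
  "is_arg_min (straggler_obj \<rho>1 \<rho>2 \<sigma> \<kappa> \<gamma> D l) (straggler_feasible \<kappa> \<gamma> D fmax l) f \<longleftrightarrow> f = f_opt"
  unfolding is_arg_min_def using f_opt_strict_min f_opt_feasible by (metis order.asym)

lemma straggler_opt_eq: "straggler_opt \<rho>1 \<rho>2 \<sigma> \<kappa> \<gamma> D fmax l = f_opt"
  by (simp add: straggler_opt_def is_arg_min_straggler_iff)

text \<open>Each competitor is compared with \<open>f_opt\<close> in the problem of its own
  straggler; \<open>f_opt\<close> is feasible there for every \<open>l\<close>, and both values
  agree with \<open>Q1\<close>.\<close>

lemma is_arg_min_Q1: "is_arg_min (Q1 \<rho>1 \<rho>2 \<sigma> \<kappa> \<gamma> D) (SP1_feasible fmax) f_opt"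
  unfolding is_arg_min_linorder
proof (intro conjI allI impI)
  show "SP1_feasible fmax f_opt"
    using f_opt_feasible by (simp add: straggler_feasible_iff)
next
  fix f assume "SP1_feasible fmax f"
  then obtain l where l: "straggler_feasible \<kappa> \<gamma> D fmax l f"
    using straggler_exists by blast
  have "straggler_obj \<rho>1 \<rho>2 \<sigma> \<kappa> \<gamma> D l f_opt \<le> straggler_obj \<rho>1 \<rho>2 \<sigma> \<kappa> \<gamma> D l f"
    using f_opt_strict_min[OF l] by (cases "f = f_opt") auto
  then show "Q1 \<rho>1 \<rho>2 \<sigma> \<kappa> \<gamma> D f_opt \<le> Q1 \<rho>1 \<rho>2 \<sigma> \<kappa> \<gamma> D f"
    using Q1_eq_straggler_obj[OF l] Q1_eq_straggler_obj[OF f_opt_feasible] by simp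
qed

end

theorem theorem2:
  fixes \<rho>1 \<rho>2 :: real
    and \<sigma> \<kappa> \<gamma> D fmax :: "'k::finite \<Rightarrow> real"
  assumes "\<rho>1 > 0" and "\<rho>2 > 0"
    and "\<And>k. \<sigma> k > 0" and "\<And>k. \<kappa> k > 0" and "\<And>k. \<gamma> k > 0" and "\<And>k. D k > 0"
    and "\<And>k. fmax k > 0"
  shows "(\<forall>l. \<exists>!f. is_arg_min (straggler_obj \<rho>1 \<rho>2 \<sigma> \<kappa> \<gamma> D l) (straggler_feasible \<kappa> \<gamma> D fmax l) f)
    \<and> (\<exists>f. is_arg_min (Q1 \<rho>1 \<rho>2 \<sigma> \<kappa> \<gamma> D) (\<lambda>g. g \<in> range (straggler_opt \<rho>1 \<rho>2 \<sigma> \<kappa> \<gamma> D fmax)) f)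
    \<and> (\<forall>f. is_arg_min (Q1 \<rho>1 \<rho>2 \<sigma> \<kappa> \<gamma> D) (\<lambda>g. g \<in> range (straggler_opt \<rho>1 \<rho>2 \<sigma> \<kappa> \<gamma> D fmax)) f
          \<longrightarrow> is_arg_min (Q1 \<rho>1 \<rho>2 \<sigma> \<kappa> \<gamma> D) (SP1_feasible fmax) f)"
proof -
  interpret straggler_problem \<rho>1 \<rho>2 \<sigma> \<kappa> \<gamma> D fmax
    by unfold_locales (fact assms)+
  \<comment> \<open>All straggler optima coincide, so the candidate set is the singleton of
    \<open>f_opt\<close>.\<close>
  have "is_arg_min (Q1 \<rho>1 \<rho>2 \<sigma> \<kappa> \<gamma> D) (\<lambda>g. g \<in> range (straggler_opt \<rho>1 \<rho>2 \<sigma> \<kappa> \<gamma> D fmax)) f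
      \<longleftrightarrow> f = f_opt" for f
    by (auto simp: is_arg_min_def straggler_opt_eq)
  then show ?thesis
    using is_arg_min_Q1 by (simp add: is_arg_min_straggler_iff)
qed

end
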